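(* Every efficient solution of the multi-objective robust counterpart $$\min_{q\in Q} z^R(q)=\Big(\max_{c\in\mathcal U}\sum_{e\in q}c_{e,1},\dots,\max_{c\in\mathcal U}\sum_{e\in q}c_{e,k}\Big)\qquad(\mathrm{RC})$$ is an efficient solution of the deterministic multi-objective problem with $\sum_{i=1}^k(\Gamma_i+1)$ objectives $$\min_{q\in Q} z^L(q)\qquad(\mathrm{D}),$$ where $z^L(q)$ is the vector whose entries are, for each $i=1,\dots,k$ in turn, $$\sum_{e\in q}\hat c_{e,i},\quad \max_{e\in q}\delta_{e,i},\quad 2\text{-}\max_{e\in q}\delta_{e,i},\ \dots,\ \Gamma_i\text{-}\max_{e\in q}\delta_{e,i}.$$ Moreover, every complete set of efficient solutions of (D) contains a complete set of efficient solutions of (RC).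
   Context: Vectors: $y^1$ dominates $y^2$ if $y^1_i\le y^2_i$ for all $i$ and $y^1\ne y^2$. For a multi-objective problem $\min_{x\in X}f(x)$, $x'$ dominates $x$ if $f(x')$ dominates $f(x)$; $x\in X$ is efficient if no $x'\in X$ dominates it; two efficient solutions $x,x'$ are equivalent if $f(x)=f(x')$; a set $\bar X\subseteq X$ of efficient solutions is complete if every $x\in X\setminus\bar X$ is dominated by or equivalent to some $x'\in\bar X$. $E$ is a finite set, $Q\subseteq 2^E$ the set of feasible solutions, $k\ge 2$; for $e\in E$, $i\in\{1,\dots,k\}$ there are a nominal cost $\hat c_{e,i}\in\mathbb R$ and an interval length $\delta_{e,i}\ge0$; $\Gamma_1,\dots,\Gamma_k$ are integers with $0\le\Gamma_i\le|E|$. The cardinality-constrained uncertainty set is $$\mathcal U=\{c\in\mathbb R^{|E|\times k}: c_{e,i}\in[\hat c_{e,i},\hat c_{e,i}+\delta_{e,i}]\ \forall e,i;\ |\{e: c_{e,i}>\hat c_{e,i}\}|\le\Gamma_i\ \forall i\}.$$ For $q\subseteq E$, $j\text{-}\max_{e\in q}\delta_{e,i}$ is the $j$-th largest among the values $\delta_{e,i}$, $e\in q$, counted with multiplicity (so $1\text{-}\max=\max$), and it is defined to be $0$ if $q$ has fewer than $j$ elements. *)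

theory Defs
  imports Complex_Main "HOL-Library.FuncSet" "HOL-Library.Multiset"
begin

(* Objective vectors are lists; objective functions f below always produce
   vectors of one fixed length. *)

definition dominates :: "real list \<Rightarrow> real list \<Rightarrow> bool" where
  "dominates y1 y2 \<longleftrightarrow> list_all2 (\<le>) y1 y2 \<and> y1 \<noteq> y2"

definition efficient :: "'x set \<Rightarrow> ('x \<Rightarrow> real list) \<Rightarrow> 'x \<Rightarrow> bool" where
  "efficient X f x \<longleftrightarrow> x \<in> X \<and> \<not> (\<exists>x'\<in>X. dominates (f x') (f x))"

definition equivalent :: "'x set \<Rightarrow> ('x \<Rightarrow> real list) \<Rightarrow> 'x \<Rightarrow> 'x \<Rightarrow> bool" where
  "equivalent X f x x' \<longleftrightarrow> efficient X f x \<and> efficient X f x' \<and> f x = f x'"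

definition complete_set :: "'x set \<Rightarrow> ('x \<Rightarrow> real list) \<Rightarrow> 'x set \<Rightarrow> bool" where
  "complete_set X f C \<longleftrightarrow>
     (\<forall>x\<in>C. efficient X f x) \<and>
     (\<forall>x\<in>X - C. \<exists>x'\<in>C. dominates (f x') (f x) \<or> equivalent X f x x')"

(* A cost matrix in R^(E x k) is a function that is extensional outside
   E and {1..k}. *)

definition uncertainty_set ::
  "'e set \<Rightarrow> nat \<Rightarrow> ('e \<Rightarrow> nat \<Rightarrow> real) \<Rightarrow> ('e \<Rightarrow> nat \<Rightarrow> real) \<Rightarrow> (nat \<Rightarrow> nat) \<Rightarrow> ('e \<Rightarrow> nat \<Rightarrow> real) set"
where
  "uncertainty_set E k chat \<delta> \<Gamma> =
     {c \<in> E \<rightarrow>\<^sub>E ({1..k} \<rightarrow>\<^sub>E UNIV).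
        (\<forall>e\<in>E. \<forall>i\<in>{1..k}. c e i \<in> {chat e i .. chat e i + \<delta> e i}) \<and>
        (\<forall>i\<in>{1..k}. card {e \<in> E. c e i > chat e i} \<le> \<Gamma> i)}"

(* The set of values is infinite in general, so its maximum is GREATEST
   rather than Max (which is only meaningful on finite sets). *)

definition robust_objective ::
  "'e set \<Rightarrow> nat \<Rightarrow> ('e \<Rightarrow> nat \<Rightarrow> real) \<Rightarrow> ('e \<Rightarrow> nat \<Rightarrow> real) \<Rightarrow> (nat \<Rightarrow> nat) \<Rightarrow> 'e set \<Rightarrow> real list"
where
  "robust_objective E k chat \<delta> \<Gamma> q =
     map (\<lambda>i. GREATEST v. \<exists>c\<in>uncertainty_set E k chat \<delta> \<Gamma>. v = (\<Sum>e\<in>q. c e i)) [1..<k+1]"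

(* The j-th largest value (j >= 1) of d on the finite set q, with multiplicity. *)

definition jmax :: "nat \<Rightarrow> ('e \<Rightarrow> real) \<Rightarrow> 'e set \<Rightarrow> real" where
  "jmax j d q =
     (if card q < j then 0
      else rev (sorted_list_of_multiset (image_mset d (mset_set q))) ! (j - 1))"

definition deterministic_objective ::
  "nat \<Rightarrow> ('e \<Rightarrow> nat \<Rightarrow> real) \<Rightarrow> ('e \<Rightarrow> nat \<Rightarrow> real) \<Rightarrow> (nat \<Rightarrow> nat) \<Rightarrow> 'e set \<Rightarrow> real list"
where
  "deterministic_objective k chat \<delta> \<Gamma> q =
     concat (map (\<lambda>i. (\<Sum>e\<in>q. chat e i) # map (\<lambda>j. jmax j (\<lambda>e. \<delta> e i) q) [1..<\<Gamma> i + 1])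
                 [1..<k+1])"

end

theory Submission
  imports Defs
begin

text \<open>
  The robust value of \<open>q\<close> in objective \<open>i\<close> is the sum of the \<open>i\<close>-th block of the deterministic
  vector. The adversary may raise at most \<open>\<Gamma> i\<close> costs, each by at most \<open>\<delta> e i\<close>, so the best
  attack raises the \<open>\<Gamma> i\<close> largest intervals of \<open>q\<close> fully; this adds the first \<open>\<Gamma> i\<close> of the
  \<open>j\<close>-max values to the nominal cost (\<open>robust_objective_eq_block_sums\<close>).

  Summation over blocks is strictly monotone in the componentwise order, so dominance in the
  deterministic problem forces dominance in the robust problem
  (\<open>dominates_concat_imp_dominates_sums\<close>), and equal deterministic vectors give equal robust
  vectors. The theorem follows from these two facts alone
  (\<open>efficient_of_strictly_coarser\<close>, \<open>complete_set_of_strictly_coarser\<close>): a robust efficient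
  solution cannot be dominated in the finer problem, so a complete set of the finer problem holds
  a solution with the same objective vector. The robust efficient members of that
  set are therefore complete, because on a finite feasible set every inefficient solution is
  dominated by an efficient one.
\<close>

section \<open>Dominance and complete sets\<close>

lemma dominates_trans:
  assumes "dominates x y" and "dominates y z"
  shows "dominates x z"
proof -
  have xy: "list_all2 (\<le>) x y" and "x \<noteq> y" and yz: "list_all2 (\<le>) y z"
    using assms by (auto simp: dominates_def)
  have "x \<noteq> z"
  proof
    assume "x = z"
    then have "x = y"
      using xy yz by (intro nth_equalityI) (auto simp: list_all2_conv_all_nth intro: antisym)
    then show False
      using \<open>x \<noteq> y\<close> by simp
  qed
  moreover have "list_all2 (\<le>) x z"
    using xy yz by (rule list_all2_trans[rotated]) simp
  ultimately show ?thesis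
    by (simp add: dominates_def)
qed

lemma not_dominates_self [simp]: "\<not> dominates x x"
  by (simp add: dominates_def)

text \<open>
  Finiteness matters: passing to a dominating solution shrinks the set of solutions that
  dominate, so the descent stops at an efficient one.
\<close>

lemma efficient_or_dominated_by_efficient:
  assumes "finite X" and "x \<in> X"
  shows "\<exists>y. efficient X f y \<and> (y = x \<or> dominates (f y) (f x))"
  using \<open>x \<in> X\<close>
proof (induction "card {y \<in> X. dominates (f y) (f x)}" arbitrary: x rule: less_induct)
  case less
  show ?case
  proof (cases "efficient X f x")
    case True
    then show ?thesis by blast
  next
    case False
    then obtain z where z: "z \<in> X" "dominates (f z) (f x)"
      using less.prems by (auto simp: efficient_def)
    have "{y \<in> X. dominates (f y) (f z)} \<subset> {y \<in> X. dominates (f y) (f x)}"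
    proof
      show "{y \<in> X. dominates (f y) (f z)} \<subseteq> {y \<in> X. dominates (f y) (f x)}"
        using z(2) dominates_trans by blast
      have "z \<in> {y \<in> X. dominates (f y) (f x)} - {y \<in> X. dominates (f y) (f z)}"
        using z by simp
      then show "{y \<in> X. dominates (f y) (f z)} \<noteq> {y \<in> X. dominates (f y) (f x)}"
        by blast
    qed
    then have "card {y \<in> X. dominates (f y) (f z)} < card {y \<in> X. dominates (f y) (f x)}"
      using \<open>finite X\<close> by (intro psubset_card_mono) auto
    then obtain y where "efficient X f y" "y = z \<or> dominates (f y) (f z)"
      using less.hyps z(1) by blast
    then show ?thesis
      using z(2) dominates_trans by blast
  qed
qed

lemma efficient_of_strictly_coarser:
  assumes dom: "\<And>x y. x \<in> X \<Longrightarrow> y \<in> X \<Longrightarrow> dominates (g x) (g y) \<Longrightarrow> dominates (f x) (f y)"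
    and "efficient X f x"
  shows "efficient X g x"
  using assms unfolding efficient_def by blast

text \<open>
  The subset is the set of those elements of \<open>C\<close> that are efficient for \<open>f\<close>. A solution outside
  it is dominated by, or is, an efficient solution \<open>y\<close> for \<open>f\<close>. As \<open>y\<close> is efficient for \<open>g\<close> too,
  \<open>C\<close> has an element with the same \<open>g\<close>-value, and hence with the same \<open>f\<close>-value.
\<close>

lemma complete_set_of_strictly_coarser:
  assumes "finite X"
    and dom: "\<And>x y. x \<in> X \<Longrightarrow> y \<in> X \<Longrightarrow> dominates (g x) (g y) \<Longrightarrow> dominates (f x) (f y)"
    and eq: "\<And>x y. x \<in> X \<Longrightarrow> y \<in> X \<Longrightarrow> g x = g y \<Longrightarrow> f x = f y"
    and C: "complete_set X g C"
  shows "complete_set X f {x \<in> C. efficient X f x}"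
  unfolding complete_set_def
proof (intro conjI ballI)
  fix x assume x: "x \<in> X - {x \<in> C. efficient X f x}"
  obtain y where y: "efficient X f y" "y = x \<or> dominates (f y) (f x)"
    using efficient_or_dominated_by_efficient[OF \<open>finite X\<close>] x by blast
  have yX: "y \<in> X" and yg: "efficient X g y"
    using y(1) efficient_of_strictly_coarser[of X g f y] dom by (auto simp: efficient_def)
  obtain x' where x': "x' \<in> C" "g x' = g y"
  proof (cases "y \<in> C")
    case True
    then show ?thesis using that by blast
  next
    case False
    then obtain x' where "x' \<in> C" "dominates (g x') (g y) \<or> equivalent X g y x'"
      using C yX unfolding complete_set_def by blast
    moreover have "\<not> dominates (g x') (g y)"
      using yg C \<open>x' \<in> C\<close> by (auto simp: efficient_def complete_set_def)
    ultimately show ?thesis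
      using that by (auto simp: equivalent_def)
  qed
  have x'X: "x' \<in> X"
    using C x'(1) by (auto simp: efficient_def complete_set_def)
  have f_eq: "f x' = f y"
    using eq x'X yX x'(2) by blast
  have "efficient X f x'"
    using y(1) f_eq x'X by (simp add: efficient_def)
  moreover have "dominates (f x') (f x) \<or> equivalent X f x x'"
    using y f_eq \<open>efficient X f x'\<close> by (auto simp: equivalent_def)
  ultimately show "\<exists>x'\<in>{x \<in> C. efficient X f x}. dominates (f x') (f x) \<or> equivalent X f x x'"
    using x'(1) by blast
qed simp

section \<open>Summing blocks of an objective vector\<close>

lemma sum_list_mono_strict:
  fixes xs ys :: "real list"
  assumes "list_all2 (\<le>) xs ys"
  shows "sum_list xs \<le> sum_list ys \<and> (sum_list xs = sum_list ys \<longrightarrow> xs = ys)"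
  using assms by (induction rule: list_all2_induct) auto

text \<open>
  Strictness is the point: an improvement in a single entry survives in its block sum, since no
  other entry of the block gets worse.
\<close>

lemma dominates_concat_imp_dominates_sums:
  assumes "list_all2 (\<lambda>xs ys. length xs = length ys) xss yss"
    and "dominates (concat xss) (concat yss)"
  shows "dominates (map sum_list xss) (map sum_list yss)"
proof -
  have "list_all2 (\<le>) (map sum_list xss) (map sum_list yss) \<and>
      (map sum_list xss = map sum_list yss \<longrightarrow> xss = yss)"
    if "list_all2 (\<le>) (concat xss) (concat yss)"
    using assms(1) that
    by (induction rule: list_all2_induct) (auto simp: list_all2_append dest: sum_list_mono_strict)
  then show ?thesis
    using assms(2) by (auto simp: dominates_def)
qed

section \<open>The largest values of a function on a finite set\<close>

text \<open>
  The sorted multiset of values forgets which elements attain them. An attack on \<open>q\<close> is a set of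
  elements, so the values are listed together with elements that attain them.
\<close>

lemma ex_decreasing_enumeration:
  fixes d :: "'e \<Rightarrow> real"
  assumes "finite q"
  obtains xs where "distinct xs" "set xs = q"
    "rev (sorted_list_of_multiset (image_mset d (mset_set q))) = map d xs"
    "sorted (rev (map d xs))"
proof -
  obtain zs where zs: "distinct zs" "set zs = q"
    using finite_distinct_list[OF assms] by blast
  define xs where "xs = rev (sort_key d zs)"
  have "sorted_list_of_multiset (image_mset d (mset_set q)) = sort (map d zs)"
  proof -
    have "image_mset d (mset_set q) = mset (map d zs)"
      using mset_set_set[OF zs(1)] zs(2) by simp
    then show ?thesis
      by (simp only: sorted_list_of_multiset_mset)
  qed
  also have "\<dots> = map d (sort_key d zs)"
    by (rule properties_for_sort) simp_all
  finally show ?thesis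
    using that[of xs] zs by (simp add: xs_def rev_map)
qed

text \<open>
  The value \<open>0\<close> of \<open>jmax\<close> beyond the size of \<open>q\<close> matches the fact that \<open>take\<close> stops growing there.
\<close>

lemma sum_jmax_eq_sum_take:
  assumes "distinct xs" and "set xs = q"
    and "rev (sorted_list_of_multiset (image_mset d (mset_set q))) = map d xs"
  shows "(\<Sum>j\<leftarrow>[1..<n + 1]. jmax j d q) = (\<Sum>e\<in>set (take n xs). d e)"
proof (induction n)
  case (Suc n)
  have card: "card q = length xs"
    using assms(1,2) distinct_card by blast
  show ?case
  proof (cases "n < length xs")
    case True
    then have "xs ! n \<notin> set (take n xs)"
      using assms(1) by (auto simp: in_set_conv_nth nth_eq_iff_index_eq)
    then show ?thesis
      using Suc True card assms(3) by (simp add: take_Suc_conv_app_nth jmax_def)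
  next
    case False
    then show ?thesis
      using Suc card by (simp add: jmax_def)
  qed
qed simp

text \<open>
  Exchange argument: the value \<open>d (xs ! n)\<close> just below the prefix separates the two sides. Elements
  of \<open>S\<close> outside the prefix are at most this value, elements of the prefix are at least
  this value, and the former are not more numerous than the prefix elements missing from \<open>S\<close>.
  Having fewer elements cannot help \<open>S\<close>, because the separating value is nonnegative.
\<close>

lemma sum_le_sum_take_decreasing:
  fixes d :: "'e \<Rightarrow> real"
  assumes "distinct xs" and sorted: "sorted (rev (map d xs))"
    and nonneg: "\<And>e. e \<in> set xs \<Longrightarrow> d e \<ge> 0"
    and S: "S \<subseteq> set xs" "card S \<le> n"
  shows "sum d S \<le> (\<Sum>e\<in>set (take n xs). d e)"
proof (cases "n < length xs")
  case False
  then show ?thesis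
    using S nonneg by (auto intro!: sum_mono2)
next
  case True
  define T where "T = set (take n xs)"
  define t where "t = d (xs ! n)"
  have decr: "d (xs ! b) \<le> d (xs ! a)" if "a \<le> b" "b < length xs" for a b
    using sorted that by (simp add: sorted_rev_iff_nth_mono)
  have cardT: "card T = n"
    using assms(1) True by (simp add: T_def distinct_card)
  have finS: "finite S"
    using S(1) finite_subset by blast
  have T_ge: "t \<le> d e" if "e \<in> T" for e
    using that True decr by (auto simp: T_def t_def in_set_conv_nth)
  have not_T_le: "d e \<le> t" if e: "e \<in> set xs - T" for e
  proof -
    obtain b where b: "b < length xs" "e = xs ! b"
      using e by (auto simp: in_set_conv_nth)
    then have "n \<le> b"
      using e by (auto simp: T_def in_set_conv_nth not_less[symmetric])
    then show ?thesis
      using decr b by (simp add: t_def)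
  qed
  have "card (S \<inter> T) + card (S - T) = card S" "card (S \<inter> T) + card (T - S) = card T"
    using card_Int_Diff[OF finS, of T] card_Int_Diff[of T S]
    by (simp_all add: T_def Int_commute)
  then have card_le: "card (S - T) \<le> card (T - S)"
    using S(2) cardT by linarith
  have "sum d (S - T) \<le> of_nat (card (S - T)) * t"
    using S(1) by (intro sum_bounded_above not_T_le) auto
  also have "\<dots> \<le> of_nat (card (T - S)) * t"
    using card_le nonneg True by (intro mult_right_mono) (auto simp: t_def)
  also have "\<dots> \<le> sum d (T - S)"
    by (intro sum_bounded_below T_ge) auto
  finally have "sum d (S \<inter> T) + sum d (S - T) \<le> sum d (T \<inter> S) + sum d (T - S)"
    by (simp add: Int_commute)
  then show ?thesis
    using sum.Int_Diff[OF finS, of d T] sum.Int_Diff[of T d S] by (simp add: T_def)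
qed

section \<open>The robust objective value\<close>

text \<open>
  A worst case raises, to their upper bounds, the costs of the prefix of length \<open>\<Gamma> i\<close> of a decreasing
  enumeration of \<open>q\<close>. Any scenario raises at most \<open>\<Gamma> i\<close> costs within \<open>q\<close>, so the exchange
  argument bounds it.
\<close>

lemma worst_case_cost:
  fixes chat \<delta> :: "'e \<Rightarrow> nat \<Rightarrow> real"
  assumes "finite E" and "q \<subseteq> E" and i: "i \<in> {1..k}"
    and nonneg: "\<And>e i. e \<in> E \<Longrightarrow> i \<in> {1..k} \<Longrightarrow> \<delta> e i \<ge> 0"
  shows "(GREATEST v. \<exists>c\<in>uncertainty_set E k chat \<delta> \<Gamma>. v = (\<Sum>e\<in>q. c e i)) =
    (\<Sum>e\<in>q. chat e i) + (\<Sum>j\<leftarrow>[1..<\<Gamma> i + 1]. jmax j (\<lambda>e. \<delta> e i) q)"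
proof -
  have finq: "finite q"
    using assms(1,2) finite_subset by blast
  obtain xs where xs: "distinct xs" "set xs = q"
    "rev (sorted_list_of_multiset (image_mset (\<lambda>e. \<delta> e i) (mset_set q))) = map (\<lambda>e. \<delta> e i) xs"
    "sorted (rev (map (\<lambda>e. \<delta> e i) xs))"
    using ex_decreasing_enumeration[OF finq, of "\<lambda>e. \<delta> e i"] by blast
  define T where "T = set (take (\<Gamma> i) xs)"
  have T: "T \<subseteq> q" "card T \<le> \<Gamma> i" "finite T"
    using xs(1,2) set_take_subset[of "\<Gamma> i" xs] by (auto simp: T_def distinct_card)
  have top: "(\<Sum>j\<leftarrow>[1..<\<Gamma> i + 1]. jmax j (\<lambda>e. \<delta> e i) q) = (\<Sum>e\<in>T. \<delta> e i)"
    using sum_jmax_eq_sum_take[OF xs(1-3)] by (simp add: T_def)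
  define c where "c = (\<lambda>e\<in>E. \<lambda>l\<in>{1..k}. chat e l + (if l = i \<and> e \<in> T then \<delta> e l else 0))"
  have c_mem: "c \<in> uncertainty_set E k chat \<delta> \<Gamma>"
  proof -
    have "card {e \<in> E. c e l > chat e l} \<le> \<Gamma> l" if "l \<in> {1..k}" for l
    proof (cases "l = i")
      case True
      have "{e \<in> E. c e l > chat e l} \<subseteq> T"
        using that by (auto simp: c_def split: if_splits)
      then show ?thesis
        using T True card_mono order_trans by blast
    next
      case False
      then have "{e \<in> E. c e l > chat e l} = {}"
        using that by (auto simp: c_def)
      then show ?thesis by (simp only: card.empty le0)
    qed
    then show ?thesis
      using nonneg by (auto simp: uncertainty_set_def c_def)
  qed
  have c_val: "(\<Sum>e\<in>q. c e i) = (\<Sum>e\<in>q. chat e i) + (\<Sum>e\<in>T. \<delta> e i)"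
  proof -
    have "(\<Sum>e\<in>q. c e i) = (\<Sum>e\<in>q. chat e i + (if e \<in> T then \<delta> e i else 0))"
      using assms(2) i by (intro sum.cong) (auto simp: c_def)
    also have "\<dots> = (\<Sum>e\<in>q. chat e i) + (\<Sum>e\<in>q \<inter> T. \<delta> e i)"
      by (simp add: sum.distrib sum.inter_restrict[OF finq])
    finally show ?thesis
      using T(1) by (simp add: Int_absorb1)
  qed
  have upper: "(\<Sum>e\<in>q. b e i) \<le> (\<Sum>e\<in>q. chat e i) + (\<Sum>e\<in>T. \<delta> e i)"
    if b: "b \<in> uncertainty_set E k chat \<delta> \<Gamma>" for b
  proof -
    define S where "S = {e \<in> q. b e i > chat e i}"
    have "card S \<le> card {e \<in> E. b e i > chat e i}"
      using assms(1,2) by (intro card_mono) (auto simp: S_def)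
    also have "\<dots> \<le> \<Gamma> i"
      using b i by (simp add: uncertainty_set_def)
    finally have "card S \<le> \<Gamma> i" .
    then have "(\<Sum>e\<in>S. \<delta> e i) \<le> (\<Sum>e\<in>T. \<delta> e i)"
      unfolding T_def using xs(1,2,4) nonneg assms(2) i
      by (intro sum_le_sum_take_decreasing) (auto simp: S_def)
    moreover have "(\<Sum>e\<in>q. b e i) \<le> (\<Sum>e\<in>q. chat e i + (if e \<in> S then \<delta> e i else 0))"
      using b assms(2) i by (intro sum_mono) (auto simp: uncertainty_set_def S_def)
    moreover have "(\<Sum>e\<in>q. chat e i + (if e \<in> S then \<delta> e i else 0)) =
        (\<Sum>e\<in>q. chat e i) + (\<Sum>e\<in>S. \<delta> e i)"
    proof -
      have "q \<inter> S = S" by (auto simp: S_def)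
      then show ?thesis
        by (simp add: sum.distrib flip: sum.inter_restrict[OF finq])
    qed
    ultimately show ?thesis by linarith
  qed
  show ?thesis
    unfolding top using c_mem c_val upper
    by (intro Greatest_equality) (metis, blast)
qed

definition objective_blocks ::
  "nat \<Rightarrow> ('e \<Rightarrow> nat \<Rightarrow> real) \<Rightarrow> ('e \<Rightarrow> nat \<Rightarrow> real) \<Rightarrow> (nat \<Rightarrow> nat) \<Rightarrow> 'e set \<Rightarrow> real list list"
where
  "objective_blocks k chat \<delta> \<Gamma> q =
     map (\<lambda>i. (\<Sum>e\<in>q. chat e i) # map (\<lambda>j. jmax j (\<lambda>e. \<delta> e i) q) [1..<\<Gamma> i + 1]) [1..<k+1]"

lemma deterministic_objective_eq_concat_blocks:
  "deterministic_objective k chat \<delta> \<Gamma> q = concat (objective_blocks k chat \<delta> \<Gamma> q)"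
  by (simp add: deterministic_objective_def objective_blocks_def)

lemma robust_objective_eq_block_sums:
  assumes "finite E" and "q \<subseteq> E"
    and "\<And>e i. e \<in> E \<Longrightarrow> i \<in> {1..k} \<Longrightarrow> \<delta> e i \<ge> 0"
  shows "robust_objective E k chat \<delta> \<Gamma> q = map sum_list (objective_blocks k chat \<delta> \<Gamma> q)"
proof -
  have "(GREATEST v. \<exists>c\<in>uncertainty_set E k chat \<delta> \<Gamma>. v = (\<Sum>e\<in>q. c e i)) =
      (\<Sum>e\<in>q. chat e i) + (\<Sum>j\<leftarrow>[1..<\<Gamma> i + 1]. jmax j (\<lambda>e. \<delta> e i) q)" if "i \<in> set [1..<k+1]" for i
    using that assms by (intro worst_case_cost) auto
  then show ?thesis
    unfolding robust_objective_def objective_blocks_def by simp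
qed

lemma objective_blocks_same_shape:
  "list_all2 (\<lambda>xs ys. length xs = length ys)
     (objective_blocks k chat \<delta> \<Gamma> q) (objective_blocks k chat \<delta> \<Gamma> q')"
  by (simp add: objective_blocks_def list_all2_conv_all_nth)

lemma blocks_eq_of_concat_eq:
  assumes "list_all2 (\<lambda>xs ys. length xs = length ys) xss yss" and "concat xss = concat yss"
  shows "xss = yss"
  using assms by (induction rule: list_all2_induct) auto

theorem theorem30:
  fixes E :: "'e set" and Q :: "'e set set" and k :: nat
    and chat \<delta> :: "'e \<Rightarrow> nat \<Rightarrow> real" and \<Gamma> :: "nat \<Rightarrow> nat"
  assumes "finite E"
    and "Q \<subseteq> Pow E"
    and "k \<ge> 2"
    and "\<And>e i. e \<in> E \<Longrightarrow> i \<in> {1..k} \<Longrightarrow> \<delta> e i \<ge> 0"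
    and "\<And>i. i \<in> {1..k} \<Longrightarrow> \<Gamma> i \<le> card E"
  shows "(\<forall>q. efficient Q (robust_objective E k chat \<delta> \<Gamma>) q \<longrightarrow>
              efficient Q (deterministic_objective k chat \<delta> \<Gamma>) q) \<and>
         (\<forall>C. complete_set Q (deterministic_objective k chat \<delta> \<Gamma>) C \<longrightarrow>
              (\<exists>D\<subseteq>C. complete_set Q (robust_objective E k chat \<delta> \<Gamma>) D))"
proof -
  let ?R = "robust_objective E k chat \<delta> \<Gamma>" and ?L = "deterministic_objective k chat \<delta> \<Gamma>"
  have R: "?R q = map sum_list (objective_blocks k chat \<delta> \<Gamma> q)" if "q \<in> Q" for q
    using that assms(1,2,4) by (intro robust_objective_eq_block_sums) auto
  have dom: "dominates (?R q) (?R q')" if "q \<in> Q" "q' \<in> Q" "dominates (?L q) (?L q')" for q q'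
    using that R objective_blocks_same_shape dominates_concat_imp_dominates_sums
    by (metis deterministic_objective_eq_concat_blocks)
  have eq: "?R q = ?R q'" if "q \<in> Q" "q' \<in> Q" "?L q = ?L q'" for q q'
    using that R objective_blocks_same_shape blocks_eq_of_concat_eq
    by (metis deterministic_objective_eq_concat_blocks)
  have "finite Q"
    using assms(1,2) finite_subset by blast
  show ?thesis
  proof (intro conjI allI impI)
    fix q assume "efficient Q ?R q"
    then show "efficient Q ?L q"
      using dom by (rule efficient_of_strictly_coarser[rotated])
  next
    fix C assume "complete_set Q ?L C"
    then have "complete_set Q ?R {q \<in> C. efficient Q ?R q}"
      using complete_set_of_strictly_coarser[OF \<open>finite Q\<close>, of ?L ?R C] dom eq by blast
    then show "\<exists>D\<subseteq>C. complete_set Q ?R D"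
      by (intro exI[of _ "{q \<in> C. efficient Q ?R q}"]) auto
  qed
qed

end
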